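(* Fix a type $\Delta$. If $(\mathcal F,\mathcal D)$ is a finite homomorphism duality, then $\mathrm{GCSP}(\mathcal D)$ is solvable by a polynomial-time algorithm.
   Context: A type is a finite family $\Delta=(\delta_i:i\in I)$ of integers $\delta_i\ge 2$. A $\Delta$-structure $A$ consists of a finite non-empty base set $\underline{A}$ and relations $R_i(A)\subseteq\underline{A}^{\delta_i}$ ($i\in I$). A homomorphism $A\to B$ is a map of base sets mapping $R_i(A)$ into $R_i(B)$ for every $i$; write $A\to B$ if one exists. $A,B$ are incomparable if $A\not\to B$ and $B\not\to A$. A core is a structure not homomorphic to any proper induced substructure of itself. A finite homomorphism duality is a pair $(\mathcal F,\mathcal D)$ of finite sets of core $\Delta$-structures such that distinct elements of $\mathcal F$ are incomparable, distinct elements of $\mathcal D$ are incomparable, and for every $\Delta$-structure $A$: there exists $F\in\mathcal F$ with $F\to A$ if and only if $A\not\to D$ for all $D\in\mathcal D$. For a fixed finite set $\mathcal H$ of $\Delta$-structures, $\mathrm{GCSP}(\mathcal H)$ is the decision problem: given an input $\Delta$-structure $G$, decide whether there exists $H\in\mathcal H$ such that $G\to H$. Polynomial time is measured in the size of $G$. *)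

theory Defs
  imports "HOL-Computational_Algebra.Polynomial"
begin

text \<open>A type is given by the list of its arities, so its index set is
  \<open>{..<length \<Delta>}\<close>. Base sets are finite sets of natural numbers; up to isomorphism these are
  all finite structures. Tuples are lists.\<close>

definition is_type :: "nat list \<Rightarrow> bool" where
  "is_type \<Delta> \<longleftrightarrow> (\<forall>\<delta> \<in> set \<Delta>. 2 \<le> \<delta>)"

record rel_structure =
  base :: "nat set"
  rel :: "nat \<Rightarrow> nat list set"

text \<open>Relations at indices outside the type are required to be empty, so that equality of records
  is equality of structures.\<close>

definition is_structure :: "nat list \<Rightarrow> rel_structure \<Rightarrow> bool" where
  "is_structure \<Delta> A \<longleftrightarrow>
     finite (base A) \<and> base A \<noteq> {} \<and>
     (\<forall>i < length \<Delta>. rel A i \<subseteq> {t. length t = \<Delta> ! i \<and> set t \<subseteq> base A}) \<and>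
     (\<forall>i \<ge> length \<Delta>. rel A i = {})"

definition is_hom :: "(nat \<Rightarrow> nat) \<Rightarrow> rel_structure \<Rightarrow> rel_structure \<Rightarrow> bool" where
  "is_hom f A B \<longleftrightarrow> f ` base A \<subseteq> base B \<and> (\<forall>i. map f ` rel A i \<subseteq> rel B i)"

definition homomorphic :: "rel_structure \<Rightarrow> rel_structure \<Rightarrow> bool" where
  "homomorphic A B \<longleftrightarrow> (\<exists>f. is_hom f A B)"

definition incomparable :: "rel_structure \<Rightarrow> rel_structure \<Rightarrow> bool" where
  "incomparable A B \<longleftrightarrow> \<not> homomorphic A B \<and> \<not> homomorphic B A"

definition induced :: "rel_structure \<Rightarrow> nat set \<Rightarrow> rel_structure" where
  "induced A S = \<lparr>base = S, rel = (\<lambda>i. rel A i \<inter> lists S)\<rparr>"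

definition is_core :: "rel_structure \<Rightarrow> bool" where
  "is_core A \<longleftrightarrow> (\<forall>S. S \<noteq> {} \<and> S \<subset> base A \<longrightarrow> \<not> homomorphic A (induced A S))"

definition finite_homomorphism_duality ::
  "nat list \<Rightarrow> rel_structure set \<Rightarrow> rel_structure set \<Rightarrow> bool" where
  "finite_homomorphism_duality \<Delta> \<F> \<D> \<longleftrightarrow>
     finite \<F> \<and> finite \<D> \<and>
     (\<forall>A \<in> \<F> \<union> \<D>. is_structure \<Delta> A \<and> is_core A) \<and>
     pairwise incomparable \<F> \<and> pairwise incomparable \<D> \<and>
     (\<forall>A. is_structure \<Delta> A \<longrightarrow>
        ((\<exists>F \<in> \<F>. homomorphic F A) \<longleftrightarrow> (\<forall>D \<in> \<D>. \<not> homomorphic A D)))"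

definition GCSP :: "rel_structure set \<Rightarrow> rel_structure \<Rightarrow> bool" where
  "GCSP \<H> G \<longleftrightarrow> (\<exists>H \<in> \<H>. homomorphic G H)"

text \<open>Tapes are infinite in both directions; symbol 0 is the blank.\<close>

datatype direction = Left | Stay | Right

fun offset :: "direction \<Rightarrow> int" where
  "offset Left = -1"
| "offset Stay = 0"
| "offset Right = 1"

record turing_machine =
  tape_count :: nat
  states :: "nat set"
  alphabet :: "nat set"
  start_state :: nat
  accept_state :: nat
  reject_state :: nat
  trans :: "nat \<Rightarrow> nat list \<Rightarrow> nat \<times> (nat \<times> direction) list"

text \<open>The symbols 0, 1, 2, 3 are the blank and those used in the encoding of inputs below.\<close>

definition is_tm :: "turing_machine \<Rightarrow> bool" where
  "is_tm M \<longleftrightarrow>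
     1 \<le> tape_count M \<and> finite (states M) \<and> finite (alphabet M) \<and>
     {0, 1, 2, 3} \<subseteq> alphabet M \<and>
     {start_state M, accept_state M, reject_state M} \<subseteq> states M \<and>
     accept_state M \<noteq> reject_state M \<and>
     (\<forall>q \<in> states M. \<forall>ss \<in> lists (alphabet M). length ss = tape_count M \<longrightarrow>
        (case trans M q ss of (q', as) \<Rightarrow>
           q' \<in> states M \<and> length as = tape_count M \<and> fst ` set as \<subseteq> alphabet M))"

type_synonym tape = "(int \<Rightarrow> nat) \<times> int"  \<comment> \<open>contents and head position\<close>
type_synonym config = "nat \<times> tape list"

fun read_tape :: "tape \<Rightarrow> nat" where
  "read_tape (c, h) = c h"

fun act_tape :: "nat \<times> direction \<Rightarrow> tape \<Rightarrow> tape" where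
  "act_tape (s, d) (c, h) = (c(h := s), h + offset d)"

fun step :: "turing_machine \<Rightarrow> config \<Rightarrow> config" where
  "step M (q, ts) =
     (if q = accept_state M \<or> q = reject_state M then (q, ts)
      else case trans M q (map read_tape ts) of (q', as) \<Rightarrow> (q', map2 act_tape as ts))"

definition input_tape :: "nat list \<Rightarrow> tape" where
  "input_tape w = (\<lambda>x. if 0 \<le> x \<and> x < int (length w) then w ! nat x else 0, 0)"

definition blank_tape :: tape where
  "blank_tape = (\<lambda>_. 0, 0)"

definition initial_config :: "turing_machine \<Rightarrow> nat list \<Rightarrow> config" where
  "initial_config M w =
     (start_state M, input_tape w # replicate (tape_count M - 1) blank_tape)"

definition accepts_within :: "turing_machine \<Rightarrow> nat list \<Rightarrow> nat \<Rightarrow> bool" where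
  "accepts_within M w t \<longleftrightarrow> fst ((step M ^^ t) (initial_config M w)) = accept_state M"

definition rejects_within :: "turing_machine \<Rightarrow> nat list \<Rightarrow> nat \<Rightarrow> bool" where
  "rejects_within M w t \<longleftrightarrow> fst ((step M ^^ t) (initial_config M w)) = reject_state M"

definition structure_size :: "nat list \<Rightarrow> rel_structure \<Rightarrow> nat" where
  "structure_size \<Delta> A = card (base A) + (\<Sum>i < length \<Delta>. card (rel A i))"

definition encode_tuple :: "nat list \<Rightarrow> nat list" where
  "encode_tuple t = concat (map (\<lambda>v. replicate v 1 @ [2]) t)"

definition encode_relation :: "nat list list \<Rightarrow> nat list" where
  "encode_relation ts = concat (map encode_tuple ts) @ [3]"

definition encode_lists :: "nat \<Rightarrow> nat list list list \<Rightarrow> nat list" where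
  "encode_lists n tss = replicate n 1 @ [3] @ concat (map encode_relation tss)"

text \<open>A word encodes a structure \<open>G\<close> with \<open>n\<close> elements if it arises from some numbering
  \<open>vs\<close> of the base set by \<open>0, \<dots>, n - 1\<close> and some repetition-free listing of each relation
  (the \<open>i\<close>-th one being \<open>tss ! i\<close>). Elements are written in unary: since \<open>n\<close> is at most the
  size of \<open>G\<close> and the arities are fixed, the length of the word is polynomial in the size
  of \<open>G\<close>.\<close>

definition encodes :: "nat list \<Rightarrow> nat list \<Rightarrow> rel_structure \<Rightarrow> bool" where
  "encodes \<Delta> w G \<longleftrightarrow>
     (\<exists>vs tss. distinct vs \<and> set vs = base G \<and> length tss = length \<Delta> \<and>
        (\<forall>i < length \<Delta>. distinct (tss ! i) \<and> set (tss ! i) \<subseteq> lists {..<length vs} \<and>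
           map (\<lambda>j. vs ! j) ` set (tss ! i) = rel G i) \<and>
        w = encode_lists (length vs) tss)"

text \<open>The answer must be correct for every encoding of the input structure, and the time bound is
  a polynomial in the size of the structure itself.\<close>

definition poly_time_decidable :: "nat list \<Rightarrow> (rel_structure \<Rightarrow> bool) \<Rightarrow> bool" where
  "poly_time_decidable \<Delta> P \<longleftrightarrow>
     (\<exists>M (p :: nat poly). is_tm M \<and>
        (\<forall>G w. is_structure \<Delta> G \<and> encodes \<Delta> w G \<longrightarrow>
           (if P G then accepts_within M w (poly p (structure_size \<Delta> G))
            else rejects_within M w (poly p (structure_size \<Delta> G)))))"

end

theory Submission imports Defs "HOL-Library.Countable_Set" begin

text \<open>A duality turns the question for the right-hand side into one for the left-hand side: \<open>G\<close> maps to
  some member of \<open>\<D>\<close> iff no member of \<open>\<F>\<close> maps to \<open>G\<close>. The members of \<open>\<F>\<close> are fixed, so trying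
  all maps from their base sets into \<open>G\<close> takes polynomially many trials, and this brute force search
  is the algorithm.

  To turn it into a Turing machine, the input word is first copied to every tape. From then on
  nothing is written: the tapes are read-only copies of the input and only the heads move. The head
  of tape \<open>a\<close> standing at position \<open>v\<close> means that the element \<open>a\<close> of \<open>F\<close> is mapped to the \<open>v\<close>-th
  element of \<open>G\<close>, and one more head scans the listed relations. The search is written in a small
  while language whose store is a truth value and the list of head positions. The states of the
  machine are the continuations of the program, of which there are finitely many.

  This design makes any estimate of the running time of programs superfluous. A machine that only
  moves \<open>k\<close> heads over a word of length \<open>L\<close> has \<open>O((L + 1)^k)\<close> configurations, and a path in a
  finite graph can be shortened to one whose length is at most the number of edges; the graph of a
  deterministic machine has no more edges than configurations. So a program that terminates with its
  heads in range does so in polynomial time (\<open>exec_small_steps\<close>), and the rest is total correctness: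
  \<open>machine_outcome\<close> transfers runs of programs to the machine, and \<open>decides_hom_test\<close> shows that the
  search program tests for a homomorphism \<open>F \<rightarrow> G\<close>.\<close>

section \<open>A while language for moving heads over a word\<close>

text \<open>The contents of every tape once the input has been copied; positions outside the word are
  blank.\<close>
definition sym :: "nat list \<Rightarrow> int \<Rightarrow> nat" where
  "sym w p = (if 0 \<le> p \<and> p < int (length w) then w ! nat p else 0)"

datatype prog =
    Skip
  | Move nat direction
  | Assign "bool \<Rightarrow> nat list \<Rightarrow> bool"
  | Seq prog prog
  | Cond "bool \<Rightarrow> nat list \<Rightarrow> bool" prog prog
  | While "bool \<Rightarrow> nat list \<Rightarrow> bool" prog

type_synonym store = "bool \<times> int list"

text \<open>Moves are only possible inside \<open>{-1..<length w}\<close>. A terminating run is therefore confined to a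
  finite set of stores, from which the time bound will come. Position \<open>-1\<close> is included since heads
  detect the left end of the word by reading the blank there.\<close>

inductive exec :: "nat list \<Rightarrow> prog \<Rightarrow> store \<Rightarrow> store \<Rightarrow> bool" for w where
  Skip: "exec w Skip s s"
| Move: "\<lbrakk>j < length h; -1 \<le> h ! j + offset d; h ! j + offset d < int (length w)\<rbrakk>
    \<Longrightarrow> exec w (Move j d) (f, h) (f, h[j := h ! j + offset d])"
| Assign: "exec w (Assign u) (f, h) (u f (map (sym w) h), h)"
| Seq: "\<lbrakk>exec w c s s'; exec w d s' s''\<rbrakk> \<Longrightarrow> exec w (Seq c d) s s''"
| Cond: "exec w (if b f (map (sym w) h) then c else d) (f, h) s \<Longrightarrow> exec w (Cond b c d) (f, h) s"
| While_stop: "\<not> b f (map (sym w) h) \<Longrightarrow> exec w (While b c) (f, h) (f, h)"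
| While_loop: "\<lbrakk>b f (map (sym w) h); exec w c (f, h) s; exec w (While b c) s s'\<rbrakk>
    \<Longrightarrow> exec w (While b c) (f, h) s'"

definition in_range :: "nat list \<Rightarrow> nat \<Rightarrow> int list \<Rightarrow> bool" where
  "in_range w k h \<longleftrightarrow> length h = k \<and> set h \<subseteq> {-1..<int (length w)}"

text \<open>One step of a program, as seen by a finite control: the first argument is the stack of programs
  still to be run, and only the flag and the scanned symbols are inspected.\<close>

fun control :: "prog list \<Rightarrow> bool \<Rightarrow> nat list \<Rightarrow> prog list \<times> bool \<times> (nat \<Rightarrow> direction)" where
  "control [] f ss = ([], f, \<lambda>_. Stay)"
| "control (Skip # cs) f ss = (cs, f, \<lambda>_. Stay)"
| "control (Move j d # cs) f ss = (cs, f, (\<lambda>_. Stay)(j := d))"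
| "control (Assign u # cs) f ss = (cs, u f ss, \<lambda>_. Stay)"
| "control (Seq c d # cs) f ss = (c # d # cs, f, \<lambda>_. Stay)"
| "control (Cond b c d # cs) f ss = ((if b f ss then c else d) # cs, f, \<lambda>_. Stay)"
| "control (While b c # cs) f ss = (if b f ss then c # While b c # cs else cs, f, \<lambda>_. Stay)"

fun small_step :: "nat list \<Rightarrow> prog list \<times> store \<Rightarrow> prog list \<times> store" where
  "small_step w (cs, f, h) = (case control cs f (map (sym w) h) of (cs', f', m) \<Rightarrow>
     (cs', f', map (\<lambda>j. h ! j + offset (m j)) [0..<length h]))"

text \<open>The continuations that can be met while \<open>c\<close> is being executed, relative to what follows \<open>c\<close>. A
  loop puts itself back behind its body instead of being unrolled, which keeps this set finite.\<close>

primrec conts :: "prog \<Rightarrow> prog list set" where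
  "conts Skip = {[Skip]}"
| "conts (Move j d) = {[Move j d]}"
| "conts (Assign u) = {[Assign u]}"
| "conts (Seq c d) = {[Seq c d]} \<union> (\<lambda>l. l @ [d]) ` conts c \<union> conts d"
| "conts (Cond b c d) = {[Cond b c d]} \<union> conts c \<union> conts d"
| "conts (While b c) = {[While b c]} \<union> (\<lambda>l. l @ [While b c]) ` conts c"

lemma finite_conts: "finite (conts c)"
  by (induction c) auto

lemma conts_self: "[c] \<in> conts c"
  by (cases c) auto

lemma conts_nonempty: "l \<in> conts c \<Longrightarrow> l \<noteq> []"
  by (induction c arbitrary: l) auto

text \<open>Closure of the continuations under steps, which makes them a state set for the machine.\<close>

lemma conts_control:
  "l \<in> conts c \<Longrightarrow> fst (control (l @ cs) f ss) = cs \<or>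
    (\<exists>l' \<in> conts c. fst (control (l @ cs) f ss) = l' @ cs)"
proof (induction c arbitrary: l cs)
  case (Seq c d)
  consider "l = [Seq c d]" | l' where "l = l' @ [d]" "l' \<in> conts c" | "l \<in> conts d"
    using Seq.prems by auto
  then show ?case
  proof cases
    case 1
    have "[c] \<in> conts c" by (rule conts_self)
    with 1 show ?thesis by (auto intro!: bexI[of _ "[c] @ [d]"])
  next
    case 2
    with Seq.IH(1)[of l' "d # cs"] conts_self[of d] show ?thesis
      by (force intro: bexI[of _ "[d]"])
  next
    case 3
    with Seq.IH(2)[of l cs] show ?thesis by auto
  qed
next
  case (Cond b c d)
  consider "l = [Cond b c d]" | "l \<in> conts c" | "l \<in> conts d"
    using Cond.prems by auto
  then show ?case
  proof cases
    case 1
    with conts_self[of c] conts_self[of d] show ?thesis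
      by (cases "b f ss") (auto intro: bexI[of _ "[c]"] bexI[of _ "[d]"])
  qed (use Cond.IH in \<open>auto; blast\<close>)+
next
  case (While b c)
  consider "l = [While b c]" | l' where "l = l' @ [While b c]" "l' \<in> conts c"
    using While.prems by auto
  then show ?case
  proof cases
    case 1
    with conts_self[of c] show ?thesis by (auto intro!: bexI[of _ "[c] @ [While b c]"])
  next
    case 2
    with While.IH[of l' "While b c # cs"] show ?thesis by auto
  qed
qed auto

section \<open>Termination implies polynomial time\<close>

definition step_graph :: "nat list \<Rightarrow> nat \<Rightarrow> prog list set \<Rightarrow> (prog list \<times> store) rel" where
  "step_graph w k S = (\<lambda>x. (x, small_step w x)) ` {(cs, f, h). cs \<in> S \<and> in_range w k h}"

lemma map_nth_move:
  "map (\<lambda>i. h ! i + offset (((\<lambda>_. Stay)(j := d)) i)) [0..<length h] = h[j := h ! j + offset d]"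
  by (rule nth_equalityI) (auto simp: nth_list_update)

lemma small_step_in_graph:
  "\<lbrakk>cs \<in> S; in_range w k h; small_step w (cs, f, h) = y\<rbrakk>
    \<Longrightarrow> ((cs, f, h), y) \<in> step_graph w k S"
  by (auto simp: step_graph_def)

text \<open>A big-step run only visits configurations that belong to a finite graph given in advance: \<open>S\<close> is
  any set containing the continuations of \<open>c\<close> extended by what follows.\<close>

lemma exec_path:
  assumes "exec w c s s'" and "in_range w k (snd s)" and "\<And>l. l \<in> conts c \<Longrightarrow> l @ cs \<in> S"
  shows "((c # cs, s), (cs, s')) \<in> (step_graph w k S)\<^sup>* \<and> in_range w k (snd s')"
  using assms
proof (induction arbitrary: cs rule: exec.induct)
  case (Skip s)
  then show ?case
    by (cases s) (auto intro!: r_into_rtrancl small_step_in_graph simp: map_nth)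
next
  case (Move j h d f)
  then have "in_range w k (h[j := h ! j + offset d])"
    by (auto simp: in_range_def dest!: set_update_subset_insert[THEN subsetD])
  then show ?case
    using Move by (auto intro!: r_into_rtrancl small_step_in_graph simp: map_nth_move simp del: fun_upd_apply)
next
  case (Assign u f h)
  then show ?case
    by (auto intro!: r_into_rtrancl small_step_in_graph simp: map_nth)
next
  case (Seq c s s' d s'')
  have "((Seq c d # cs, s), (c # d # cs, s)) \<in> step_graph w k S"
    using Seq.prems(1) Seq.prems(2)[of "[Seq c d]"]
    by (cases s) (auto intro!: small_step_in_graph simp: map_nth)
  moreover have "((c # d # cs, s), (d # cs, s')) \<in> (step_graph w k S)\<^sup>* \<and> in_range w k (snd s')"
    using Seq.prems(2)[of "_ @ [d]"] by (intro Seq.IH(1) Seq.prems(1)) auto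
  moreover from this have "((d # cs, s'), (cs, s'')) \<in> (step_graph w k S)\<^sup>* \<and> in_range w k (snd s'')"
    using Seq.prems(2) by (intro Seq.IH(2)) auto
  ultimately show ?case by (meson converse_rtrancl_into_rtrancl rtrancl_trans)
next
  case (Cond b f h c d s)
  let ?e = "if b f (map (sym w) h) then c else d"
  have "((Cond b c d # cs, f, h), (?e # cs, f, h)) \<in> step_graph w k S"
    using Cond.prems(1) Cond.prems(2)[OF conts_self]
    by (intro small_step_in_graph) (simp_all add: map_nth)
  moreover have "((?e # cs, f, h), (cs, s)) \<in> (step_graph w k S)\<^sup>* \<and> in_range w k (snd s)"
    using Cond.prems by (intro Cond.IH) (auto split: if_splits)
  ultimately show ?case by (meson converse_rtrancl_into_rtrancl)
next
  case (While_stop b f h c)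
  then show ?case
    using While_stop.prems(2)[OF conts_self]
    by (auto intro!: r_into_rtrancl small_step_in_graph simp: map_nth)
next
  case (While_loop b f h c s s')
  have "((While b c # cs, f, h), (c # While b c # cs, f, h)) \<in> step_graph w k S"
    using While_loop.prems(1) While_loop.prems(2)[OF conts_self] While_loop.hyps
    by (intro small_step_in_graph) (simp_all add: map_nth)
  moreover have "((c # While b c # cs, f, h), (While b c # cs, s)) \<in> (step_graph w k S)\<^sup>* \<and> in_range w k (snd s)"
    using While_loop.prems(2)[of "_ @ [While b c]"]
    by (intro While_loop.IH(1) While_loop.prems(1)) auto
  moreover from this have "((While b c # cs, s), (cs, s')) \<in> (step_graph w k S)\<^sup>* \<and> in_range w k (snd s')"
    using While_loop.prems(2) by (intro While_loop.IH(2)) auto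
  ultimately show ?case by (meson converse_rtrancl_into_rtrancl rtrancl_trans)
qed

lemma card_step_graph:
  assumes "finite S"
  shows "finite (step_graph w k S)"
    and "card (step_graph w k S) \<le> card S * 2 * (length w + 1) ^ k"
proof -
  let ?H = "{h. set h \<subseteq> {-1..<int (length w)} \<and> length h = k}"
  let ?C = "S \<times> (UNIV :: bool set) \<times> ?H"
  have C: "{(cs, f, h). cs \<in> S \<and> in_range w k h} = ?C"
    by (auto simp: in_range_def)
  have "finite ?H" by (rule finite_lists_length_eq) simp
  with assms have fin: "finite ?C" by auto
  then show "finite (step_graph w k S)"
    unfolding step_graph_def C by (rule finite_imageI)
  have "card (step_graph w k S) \<le> card ?C"
    unfolding step_graph_def C using fin by (rule card_image_le)
  also have "\<dots> = card S * 2 * (length w + 1) ^ k"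
    by (simp add: card_cartesian_product card_lists_length_eq nat_add_distrib)
  finally show "card (step_graph w k S) \<le> card S * 2 * (length w + 1) ^ k" .
qed

text \<open>The time bound comes from the graph alone: two vertices that are connected at all are connected by
  a path no longer than the number of edges, and since every vertex has only one successor this path
  is the actual computation.\<close>

lemma exec_small_steps:
  assumes "exec w c (f, h) (f', h')" and "in_range w k h"
  obtains t where "t \<le> card (conts c) * 2 * (length w + 1) ^ k"
    and "(([c], f, h), ([], f', h')) \<in> step_graph w k (conts c) ^^ t"
    and "in_range w k h'"
proof -
  note fin = card_step_graph[OF finite_conts[of c], of w k]
  have "(([c], f, h), ([], f', h')) \<in> (step_graph w k (conts c))\<^sup>*" "in_range w k h'"
    using exec_path[OF assms(1), of k "[]" "conts c"] assms(2) by auto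
  moreover from this(1) obtain t where "t \<le> card (step_graph w k (conts c))"
      "(([c], f, h), ([], f', h')) \<in> step_graph w k (conts c) ^^ t"
    unfolding rtrancl_finite_eq_relpow[OF fin(1)] by blast
  ultimately show thesis using fin(2) that by (meson le_trans)
qed


section \<open>The Turing machine of a program\<close>

definition control_states :: "prog \<Rightarrow> (prog list \<times> bool) set" where
  "control_states c = insert [] (conts c) \<times> UNIV"

definition run_state :: "prog \<Rightarrow> prog list \<Rightarrow> bool \<Rightarrow> nat" where
  "run_state c cs f = 3 + to_nat_on (control_states c) (cs, f)"

text \<open>States 0 and 1 are accepting and rejecting, state 2 copies the input to all tapes, and the others
  are the pairs of a continuation and a flag. When the copy is complete all heads stand on the blank
  after the word; they step back once, to bring them into the range in which programs run.\<close>

definition machine :: "nat \<Rightarrow> prog \<Rightarrow> turing_machine" where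
  "machine k c = \<lparr>tape_count = k,
     states = {0, 1, 2} \<union> (\<lambda>(cs, f). run_state c cs f) ` control_states c,
     alphabet = {0, 1, 2, 3}, start_state = 2, accept_state = 0, reject_state = 1,
     trans = (\<lambda>q ss.
       if q < 2 then (q, map (\<lambda>s. (s, Stay)) ss)
       else if q = 2 then
         (if hd ss = 0 then (run_state c [c] False, map (\<lambda>s. (s, Left)) ss)
          else (2, map (\<lambda>s. (hd ss, Right)) ss))
       else case from_nat_into (control_states c) (q - 3) of (cs, f) \<Rightarrow>
         if cs = [] then (if f then 0 else 1, map (\<lambda>s. (s, Stay)) ss)
         else case control cs f ss of (cs', f', m) \<Rightarrow>
           (run_state c cs' f', map (\<lambda>j. (ss ! j, m j)) [0..<length ss]))\<rparr>"

lemma machine_fields [simp]: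
  "tape_count (machine k c) = k" "alphabet (machine k c) = {0, 1, 2, 3}"
  "start_state (machine k c) = 2" "accept_state (machine k c) = 0" "reject_state (machine k c) = 1"
  "{0, 1, 2} \<subseteq> states (machine k c)"
  by (simp_all add: machine_def)

lemma finite_control_states: "finite (control_states c)"
  by (simp add: control_states_def finite_conts)

lemma decode_run_state:
  assumes "(cs, f) \<in> control_states c"
  shows "from_nat_into (control_states c) (run_state c cs f - 3) = (cs, f)"
  using assms by (simp add: run_state_def countable_finite finite_control_states)

lemma control_in_states:
  assumes "cs \<in> conts c" and "control cs f ss = (cs', f', m)"
  shows "(cs', f') \<in> control_states c"
  using conts_control[OF assms(1), of "[]" f ss] assms(2) by (auto simp: control_states_def)

lemma run_state_in_states:
  "(cs, f) \<in> control_states c \<Longrightarrow> run_state c cs f \<in> states (machine k c)"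
  by (force simp: machine_def)

lemma trans_run_state:
  assumes "(cs, f) \<in> control_states c"
  shows "trans (machine k c) (run_state c cs f) ss =
    (if cs = [] then (if f then 0 else 1, map (\<lambda>s. (s, Stay)) ss)
     else case control cs f ss of (cs', f', m) \<Rightarrow>
       (run_state c cs' f', map (\<lambda>j. (ss ! j, m j)) [0..<length ss]))"
proof -
  have "\<not> run_state c cs f < 2" "run_state c cs f \<noteq> 2" by (auto simp: run_state_def)
  with decode_run_state[OF assms] show ?thesis by (simp add: machine_def)
qed

lemma is_tm_machine:
  assumes "1 \<le> k"
  shows "is_tm (machine k c)"
proof -
  let ?M = "machine k c"
  have "case trans ?M q ss of (q', as) \<Rightarrow>
      q' \<in> states ?M \<and> length as = tape_count ?M \<and> fst ` set as \<subseteq> alphabet ?M"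
    if q: "q \<in> states ?M" and ss: "set ss \<subseteq> alphabet ?M" "length ss = tape_count ?M" for q ss
  proof -
    have k: "length ss = k" and A: "alphabet ?M = {0, 1, 2, 3}"
      using ss by (simp_all add: machine_def)
    have start: "run_state c [c] False \<in> states ?M"
      by (intro run_state_in_states) (simp add: control_states_def conts_self)
    consider "q = 0" | "q = 1" | "q = 2" | cs f where "q = run_state c cs f" "(cs, f) \<in> control_states c"
      using q by (auto simp: machine_def)
    then show ?thesis
    proof cases
      case 3
      have "hd ss \<in> set ss" using assms k by (intro hd_in_set) auto
      then show ?thesis using start 3 ss k A
        by (auto simp: machine_def)
    next
      case (4 cs f)
      show ?thesis
      proof (cases "cs = []")
        case True
        have "{0, 1} \<subseteq> states ?M" by (auto simp: machine_def)
        moreover have "([], f) \<in> control_states c" using 4(2) True by simp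
        ultimately show ?thesis using ss k by (auto simp: 4(1) True trans_run_state)
      next
        case False
        obtain cs' f' m where ctl: "control cs f ss = (cs', f', m)" by (metis prod_cases3)
        have "cs \<in> conts c" using 4(2) False by (auto simp: control_states_def)
        from control_in_states[OF this ctl] have "run_state c cs' f' \<in> states ?M"
          by (rule run_state_in_states)
        moreover have "(\<lambda>j. ss ! j) ` {0..<k} \<subseteq> alphabet ?M"
          using ss nth_mem[of _ ss] k by (metis atLeast0LessThan image_subsetI lessThan_iff subsetD)
        ultimately show ?thesis using False k ss
          by (auto simp: 4(1) trans_run_state[OF 4(2)] ctl image_image)
      qed
    qed (use ss k in \<open>auto simp: machine_def\<close>)
  qed
  then show ?thesis using assms
    unfolding is_tm_def by (auto simp: lists_eq_set finite_control_states machine_def)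
qed

definition run_config :: "nat list \<Rightarrow> prog \<Rightarrow> prog list \<times> store \<Rightarrow> config" where
  "run_config w c = (\<lambda>(cs, f, h). (run_state c cs f, map (\<lambda>p. (sym w, p)) h))"

lemma run_state_live: "run_state c cs f \<noteq> 0" "run_state c cs f \<noteq> Suc 0"
  by (simp_all add: run_state_def)

lemma step_live:
  assumes "q \<noteq> 0" "q \<noteq> 1"
  shows "step (machine k c) (q, ts) =
    (case trans (machine k c) q (map read_tape ts) of (q', as) \<Rightarrow> (q', map2 act_tape as ts))"
  using assms by (simp add: machine_def)

text \<open>Writing back the scanned symbol leaves the tapes unchanged, so the machine and the program move in
  lockstep.\<close>

lemma step_run_config:
  assumes "cs \<in> conts c"
  shows "step (machine k c) (run_config w c (cs, f, h)) = run_config w c (small_step w (cs, f, h))"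
proof -
  obtain cs' f' m where ctl: "control cs f (map (sym w) h) = (cs', f', m)" by (metis prod_cases3)
  have st: "(cs, f) \<in> control_states c" using assms by (simp add: control_states_def)
  have rd: "map read_tape (map (\<lambda>p. (sym w, p)) h) = map (sym w) h" by simp
  have "map2 act_tape (map (\<lambda>j. (map (sym w) h ! j, m j)) [0..<length h]) (map (\<lambda>p. (sym w, p)) h)
      = map (\<lambda>p. (sym w, p)) (map (\<lambda>j. h ! j + offset (m j)) [0..<length h])"
    by (rule nth_equalityI) auto
  then show ?thesis
    using conts_nonempty[OF assms]
    by (simp add: run_config_def step_live run_state_live trans_run_state[OF st] ctl comp_def
        del: step.simps)
qed

lemma steps_run_config:
  assumes "(x, y) \<in> step_graph w k (conts c) ^^ t"
  shows "(step (machine k c) ^^ t) (run_config w c x) = run_config w c y"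
  using assms
proof (induction t arbitrary: y)
  case (Suc t)
  then obtain z where z: "(x, z) \<in> step_graph w k (conts c) ^^ t" "(z, y) \<in> step_graph w k (conts c)"
    by auto
  from z(2) have "step (machine k c) (run_config w c z) = run_config w c y"
    unfolding step_graph_def using step_run_config by fast
  with Suc.IH[OF z(1)] show ?case by simp
qed simp

lemma sym_take: "j < length w \<Longrightarrow> (sym (take j w))(int j := w ! j) = sym (take (Suc j) w)"
  by (auto simp: sym_def fun_eq_iff less_Suc_eq nat_less_iff take_Suc_conv_app_nth nth_append)

text \<open>The word is free of blanks, so the first blank on tape 0 marks its end.\<close>

lemma copy_phase:
  assumes "0 \<notin> set w" and "j \<le> length w" and "1 \<le> k"
  shows "(step (machine k c) ^^ j) (initial_config (machine k c) w) =
    (2, (sym w, int j) # replicate (k - 1) (sym (take j w), int j))"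
  using assms(2)
proof (induction j)
  case 0
  have "sym [] = (\<lambda>_. 0)" by (auto simp: sym_def)
  moreover have "sym w = (\<lambda>x. if 0 \<le> x \<and> x < int (length w) then w ! nat x else 0)"
    by (auto simp: sym_def)
  ultimately show ?case
    by (simp add: initial_config_def input_tape_def blank_tape_def)
next
  case (Suc j)
  let ?ts = "(sym w, int j) # replicate (k - 1) (sym (take j w), int j)"
  have "w ! j \<noteq> 0" using Suc.prems assms(1) by (metis Suc_le_lessD nth_mem)
  moreover have sj: "sym w (int j) = w ! j" using Suc.prems by (simp add: sym_def)
  moreover have "(sym w)(int j := w ! j) = sym w" using sj by (metis fun_upd_triv)
  moreover note sym_take[of j w]
  ultimately have "step (machine k c) (2, ?ts) =
      (2, (sym w, int (Suc j)) # replicate (k - 1) (sym (take (Suc j) w), int (Suc j)))"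
    using Suc.prems
    by (simp add: machine_def map_replicate_const zip_replicate)
  then show ?case using Suc by simp
qed

lemma steps_halted:
  "fst x = accept_state M \<or> fst x = reject_state M \<Longrightarrow> (step M ^^ t) x = x"
  by (induction t) (cases x, auto)+

lemma machine_outcome:
  assumes run: "exec w c (False, replicate k (int (length w) - 1)) (f, h)"
    and w: "0 \<notin> set w" "w \<noteq> []" and k: "1 \<le> k"
    and T: "length w + 2 + card (conts c) * 2 * (length w + 1) ^ k \<le> T"
  shows "fst ((step (machine k c) ^^ T) (initial_config (machine k c) w)) = (if f then 0 else 1)"
proof -
  let ?M = "machine k c" and ?L = "length w"
  let ?h = "replicate k (int ?L - 1)"
  have "in_range w k ?h" using w(2) by (auto simp: in_range_def Suc_le_eq)
  from exec_small_steps[OF run this] obtain t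
    where t: "t \<le> card (conts c) * 2 * (?L + 1) ^ k"
      "(([c], False, ?h), ([], f, h)) \<in> step_graph w k (conts c) ^^ t" by blast
  have "(step ?M ^^ ?L) (initial_config ?M w) = (2, replicate k (sym w, int ?L))"
    using copy_phase[OF w(1) le_refl k] k by (cases k) auto
  moreover have "step ?M (2, replicate k (sym w, int ?L)) = run_config w c ([c], False, ?h)"
    using k by (cases k) (auto simp: machine_def run_config_def map_replicate_const zip_replicate sym_def
      fun_eq_iff)
  ultimately have "(step ?M ^^ (Suc ?L)) (initial_config ?M w) = run_config w c ([c], False, ?h)"
    by simp
  with steps_run_config[OF t(2)]
  have "(step ?M ^^ (t + Suc ?L)) (initial_config ?M w) = run_config w c ([], f, h)"
    by (simp only: funpow_add comp_apply)
  moreover have "fst (step ?M (run_config w c ([], f, h))) = (if f then 0 else 1)"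
    by (simp add: run_config_def step_live run_state_live trans_run_state control_states_def del: step.simps)
  ultimately have fin: "fst ((step ?M ^^ (Suc (t + Suc ?L))) (initial_config ?M w)) = (if f then 0 else 1)"
    by simp
  obtain r where "T = r + Suc (t + Suc ?L)"
    using le_Suc_ex[of "Suc (t + Suc ?L)" T] T t(1) by (auto simp: add.commute)
  then have "(step ?M ^^ T) (initial_config ?M w) =
      (step ?M ^^ r) ((step ?M ^^ (Suc (t + Suc ?L))) (initial_config ?M w))"
    by (simp only: funpow_add comp_apply)
  also have "\<dots> = (step ?M ^^ (Suc (t + Suc ?L))) (initial_config ?M w)"
    by (rule steps_halted) (use fin in \<open>auto simp: machine_def\<close>)
  finally show ?thesis using fin by simp
qed


section \<open>Programs that navigate in an encoded structure\<close>

lemma sym_nth: "i < length w \<Longrightarrow> sym w (int i) = w ! i"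
  by (simp add: sym_def)

lemma sym_eq_0_iff:
  assumes "0 \<notin> set w" "-1 \<le> p" "p < int (length w)"
  shows "sym w p = 0 \<longleftrightarrow> p = -1"
proof (cases "0 \<le> p")
  case True
  with assms(3) have "w ! nat p \<in> set w" by (intro nth_mem) (simp add: nat_less_iff)
  with assms(1) have "w ! nat p \<noteq> 0" by metis
  with True assms(3) show ?thesis by (simp add: sym_def)
qed (use assms(2) in \<open>auto simp: sym_def\<close>)

lemma exec_Move:
  "\<lbrakk>j < length h; h ! j + offset d = p; -1 \<le> p; p < int (length w)\<rbrakk>
    \<Longrightarrow> exec w (Move j d) (f, h) (f, h[j := p])"
  using exec.Move by blast

text \<open>For loops whose successive stores are known explicitly, as functions of the iteration count.\<close>

lemma exec_While_count:
  assumes "\<And>i. i < m \<Longrightarrow> b f (map (sym w) (H i)) \<and> exec w c (f, H i) (f, H (Suc i))"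
    and "\<not> b f (map (sym w) (H m))"
  shows "exec w (While b c) (f, H 0) (f, H m)"
proof -
  have "exec w (While b c) (f, H i) (f, H m)" if "i \<le> m" for i
    using that
  proof (induction rule: inc_induct)
    case base
    show ?case using assms(2) by (rule exec.While_stop)
  next
    case (step i)
    then show ?case using assms(1)[of i] exec.While_loop by blast
  qed
  then show ?thesis by simp
qed

lemma exec_in_range:
  assumes "exec w c (f, h) (f', h')" and "in_range w k h"
  shows "in_range w k h'"
  using exec_path[OF assms(1), of k "[]" UNIV] assms(2) by simp

definition rewind :: "nat \<Rightarrow> prog" where
  "rewind x = Seq (While (\<lambda>_ ss. ss ! x \<noteq> 0) (Move x Left)) (Move x Right)"

lemma exec_rewind:
  assumes "0 \<notin> set w" "w \<noteq> []" "in_range w k h" "x < k"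
  shows "exec w (rewind x) (f, h) (f, h[x := 0])"
proof -
  define m where "m = nat (h ! x + 1)"
  define H where "H i = h[x := h ! x - int i]" for i
  have len: "length h = k" using assms(3) by (simp add: in_range_def)
  have "h ! x \<in> set h" using assms(4) len by simp
  then have hx: "-1 \<le> h ! x" "h ! x < int (length w)"
    using assms(3) by (auto simp: in_range_def)
  have "exec w (While (\<lambda>_ ss. ss ! x \<noteq> 0) (Move x Left)) (f, H 0) (f, H m)"
  proof (rule exec_While_count)
    fix i assume "i < m"
    then have i: "int i < h ! x + 1" by (simp add: m_def)
    have "exec w (Move x Left) (f, H i) (f, (H i)[x := h ! x - int (Suc i)])"
      using i hx len assms(4) by (intro exec_Move) (auto simp: H_def)
    then show "map (sym w) (H i) ! x \<noteq> 0 \<and> exec w (Move x Left) (f, H i) (f, H (Suc i))"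
      using i hx len assms(4) sym_eq_0_iff[OF assms(1)] by (auto simp: H_def)
  next
    show "\<not> map (sym w) (H m) ! x \<noteq> 0"
      using hx len assms(4) by (auto simp: H_def m_def sym_def)
  qed
  moreover have "exec w (Move x Right) (f, H m) (f, (H m)[x := 0])"
    using hx len assms(2,4) by (intro exec_Move) (auto simp: H_def m_def)
  ultimately show ?thesis
    unfolding rewind_def by (auto intro: exec.Seq simp: H_def)
qed

text \<open>The symbol 3 ends the initial unary number and every listed relation, so it cuts an encoding into
  segments: segment 0 is the number of elements, and segment \<open>i + 1\<close> lists relation \<open>i\<close>.\<close>

definition skip_segment :: "nat \<Rightarrow> prog" where
  "skip_segment x = Seq (While (\<lambda>_ ss. ss ! x \<noteq> 3) (Move x Right)) (Move x Right)"

lemma exec_skip_segment: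
  assumes w: "w = p @ u @ 3 # q" and "q \<noteq> []" "3 \<notin> set u" "x < length h" "h ! x = int (length p)"
  shows "exec w (skip_segment x) (f, h) (f, h[x := int (length p + length u + 1)])"
proof -
  define H where "H i = h[x := int (length p + i)]" for i
  have "exec w (While (\<lambda>_ ss. ss ! x \<noteq> 3) (Move x Right)) (f, H 0) (f, H (length u))"
  proof (rule exec_While_count)
    fix i assume i: "i < length u"
    have "exec w (Move x Right) (f, H i) (f, (H i)[x := int (length p + Suc i)])"
      using i assms by (intro exec_Move) (auto simp: H_def)
    moreover have "sym w (int (length p + i)) = u ! i"
      using i by (subst sym_nth) (auto simp: w nth_append)
    ultimately show "map (sym w) (H i) ! x \<noteq> 3 \<and> exec w (Move x Right) (f, H i) (f, H (Suc i))"
      using i assms by (auto simp: H_def) (metis nth_mem)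
  next
    have "sym w (int (length p + length u)) = 3"
      by (subst sym_nth) (auto simp: w nth_append)
    then show "\<not> map (sym w) (H (length u)) ! x \<noteq> 3" using assms by (simp add: H_def)
  qed
  moreover have "exec w (Move x Right) (f, H (length u))
      (f, (H (length u))[x := int (length p + length u + 1)])"
    using assms by (intro exec_Move) (auto simp: H_def Suc_le_eq)
  moreover have "H 0 = h" using assms(5) by (simp add: H_def flip: assms(5))
  moreover have "(H (length u))[x := p'] = h[x := p']" for p' by (simp add: H_def)
  ultimately show ?thesis
    unfolding skip_segment_def by (auto intro: exec.Seq)
qed

primrec seek :: "nat \<Rightarrow> nat \<Rightarrow> prog" where
  "seek x 0 = rewind x"
| "seek x (Suc j) = Seq (seek x j) (skip_segment x)"

lemma exec_seek:
  assumes w: "w = concat (map (\<lambda>u. u @ [3]) us)" and "0 \<notin> set w" "\<forall>u \<in> set us. 3 \<notin> set u"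
    and "j < length us" "in_range w k h" "x < k"
  shows "exec w (seek x j) (f, h) (f, h[x := int (length (concat (map (\<lambda>u. u @ [3]) (take j us))))])"
  using assms(4)
proof (induction j)
  case 0
  then have "w \<noteq> []" using w by (cases us) auto
  with exec_rewind[OF assms(2) this assms(5,6)] show ?case by simp
next
  case (Suc j)
  let ?p = "\<lambda>j. concat (map (\<lambda>u. u @ [3]) (take j us))"
  let ?q = "concat (map (\<lambda>u. u @ [3]) (drop (Suc j) us))"
  have len: "length h = k" using assms(5) by (simp add: in_range_def)
  have next_p: "?p (Suc j) = ?p j @ us ! j @ [3]"
    using Suc.prems by (simp add: take_Suc_conv_app_nth)
  have "us = take (Suc j) us @ drop (Suc j) us" by simp
  then have "w = ?p (Suc j) @ ?q"
    unfolding w by (metis concat_append map_append)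
  then have split: "w = ?p j @ us ! j @ 3 # ?q" using next_p by simp
  moreover have "?q \<noteq> []" using Suc.prems by (simp add: Cons_nth_drop_Suc[symmetric])
  moreover have "3 \<notin> set (us ! j)" using Suc.prems assms(3) by auto
  moreover note exec_skip_segment[of w "?p j" "us ! j" ?q x "h[x := int (length (?p j))]" f]
  ultimately have "exec w (skip_segment x) (f, h[x := int (length (?p j))])
      (f, h[x := int (length (?p j) + length (us ! j) + 1)])"
    using assms(6) len by simp
  moreover have "length (?p (Suc j)) = length (?p j) + length (us ! j) + 1"
    by (simp only: next_p) simp
  ultimately show ?case using Suc by (auto intro: exec.Seq)
qed

text \<open>Compares the unary block under head \<open>s\<close> with the position of head \<open>x\<close> by moving both heads at once,
  \<open>s\<close> to the right and \<open>x\<close> to the left. The position of \<open>x\<close> is data that must survive. It is recovered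
  by running the comparison backwards until \<open>s\<close> leaves its block on the left, which is noticed because
  the symbol before a block is never 1; finally \<open>s\<close> passes the block.

  The initial step of \<open>x\<close> makes position 0 correspond to the blank, so that both heads leave the ones
  simultaneously iff the two numbers agree.\<close>

definition compare :: "nat \<Rightarrow> nat \<Rightarrow> prog" where
  "compare s x =
     Seq (Move x Left)
    (Seq (While (\<lambda>_ ss. ss ! s = 1 \<and> ss ! x \<noteq> 0) (Seq (Move s Right) (Move x Left)))
    (Seq (Assign (\<lambda>f ss. f \<and> ss ! s = 2 \<and> ss ! x = 0))
    (Seq (Seq (Move x Right) (Move s Left))
    (Seq (While (\<lambda>_ ss. ss ! s = 1) (Seq (Move x Right) (Move s Left)))
    (Seq (Move s Right)
    (Seq (While (\<lambda>_ ss. ss ! s = 1) (Move s Right)) (Move s Right)))))))"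

lemma exec_compare:
  assumes w: "w = p @ replicate v 1 @ 2 # q" and "q \<noteq> []" "p \<noteq> []" "last p \<noteq> 1"
    and w0: "0 \<notin> set w" and len: "s < length h" "x < length h" "x \<noteq> s"
    and hs: "h ! s = int (length p)" and hx: "h ! x = int c" and c: "c < length w"
  shows "exec w (compare s x) (f, h) (f \<and> v = c, h[s := int (length p + v + 1)])"
proof -
  define S where "S a b = h[s := a, x := b]" for a b :: int
  define P where "P = int (length p)"
  \<comment> \<open>the number of iterations of the comparing loop\<close>
  define m where "m = min v c"
  let ?L = "int (length w)"
  have L: "P + int v + 1 < ?L" "1 \<le> P"
    using assms(2,3) by (auto simp: w P_def Suc_le_eq)
  have S_read [simp]: "map (sym w) (S a b) ! s = sym w a" "map (sym w) (S a b) ! x = sym w b" for a b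
    using len by (simp_all add: S_def)
  have move_s: "exec w (Move s d) (f, S a b) (f, S a' b)"
    if "a' = a + offset d" "-1 \<le> a'" "a' < ?L" for d f a a' b
  proof -
    have "S a' b = (S a b)[s := a']" using len by (simp add: S_def list_update_swap)
    moreover have "exec w (Move s d) (f, S a b) (f, (S a b)[s := a'])"
      using that len by (intro exec_Move) (auto simp: S_def)
    ultimately show ?thesis by simp
  qed
  have move_x: "exec w (Move x d) (f, S a b) (f, S a b')"
    if "b' = b + offset d" "-1 \<le> b'" "b' < ?L" for d f a b b'
  proof -
    have "S a b' = (S a b)[x := b']" by (simp add: S_def)
    moreover have "exec w (Move x d) (f, S a b) (f, (S a b)[x := b'])"
      using that len by (intro exec_Move) (auto simp: S_def)
    ultimately show ?thesis by simp
  qed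
  have one: "sym w (P + int i) = 1" if "i < v" for i
    using that sym_nth[of "length p + i" w] by (simp add: P_def w nth_append)
  have two: "sym w (P + int v) = 2"
    using sym_nth[of "length p + v" w] by (simp add: P_def w nth_append)
  have before: "sym w (P - 1) \<noteq> 1"
    using sym_nth[of "length p - 1" w] assms(3,4)
    by (simp add: P_def w nth_append last_conv_nth of_nat_diff Suc_le_eq)
  have zero: "sym w b = 0 \<longleftrightarrow> b = -1" if "-1 \<le> b" "b < ?L" for b
    using sym_eq_0_iff[OF w0 that] .
  have m: "m \<le> v" "m \<le> c" by (simp_all add: m_def)
  let ?f = "f \<and> v = c"
  \<comment> \<open>The loops are stated with \<open>int 0\<close> and \<open>int m\<close> as end points to fit the rule for counted loops.\<close>
  have 1: "exec w (Move x Left) (f, S P (int c)) (f, S (P + int 0) (int c - 1 - int 0))"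
    using c move_x[of "int c - 1" "int c" Left f P] by simp
  have 2: "exec w (While (\<lambda>_ ss. ss ! s = 1 \<and> ss ! x \<noteq> 0) (Seq (Move s Right) (Move x Left)))
      (f, S (P + int 0) (int c - 1 - int 0)) (f, S (P + int m) (int c - 1 - int m))"
  proof (rule exec_While_count)
    fix i assume "i < m"
    then have i: "i < v" "i < c" by (simp_all add: m_def)
    have "exec w (Move s Right) (f, S (P + int i) (int c - 1 - int i))
        (f, S (P + int (Suc i)) (int c - 1 - int i))"
      using i L by (intro move_s) auto
    moreover have "exec w (Move x Left) (f, S (P + int (Suc i)) (int c - 1 - int i))
        (f, S (P + int (Suc i)) (int c - 1 - int (Suc i)))"
      using i c by (intro move_x) auto
    moreover have "sym w (int c - 1 - int i) \<noteq> 0" using i c by (subst zero) auto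
    ultimately show "(map (sym w) (S (P + int i) (int c - 1 - int i)) ! s = 1 \<and>
        map (sym w) (S (P + int i) (int c - 1 - int i)) ! x \<noteq> 0) \<and>
        exec w (Seq (Move s Right) (Move x Left)) (f, S (P + int i) (int c - 1 - int i))
        (f, S (P + int (Suc i)) (int c - 1 - int (Suc i)))"
      using one[OF i(1)] by (auto intro: exec.Seq)
  next
    have "sym w (int c - 1 - int m) = 0 \<longleftrightarrow> m = c" using m c by (subst zero) auto
    then show "\<not> (map (sym w) (S (P + int m) (int c - 1 - int m)) ! s = 1 \<and>
        map (sym w) (S (P + int m) (int c - 1 - int m)) ! x \<noteq> 0)"
      using two by (auto simp: m_def min_def split: if_splits)
  qed
  have "(f \<and> sym w (P + int m) = 2 \<and> sym w (int c - 1 - int m) = 0) = ?f"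
  proof -
    have "sym w (int c - 1 - int m) = 0 \<longleftrightarrow> m = c" using m c by (subst zero) auto
    moreover have "sym w (P + int m) = 2 \<longleftrightarrow> m = v"
      using one[of m] two m(1) by (cases "m = v") auto
    ultimately show ?thesis by (auto simp: m_def)
  qed
  then have 3: "exec w (Assign (\<lambda>f ss. f \<and> ss ! s = 2 \<and> ss ! x = 0))
      (f, S (P + int m) (int c - 1 - int m)) (?f, S (P + int m) (int c - 1 - int m))"
    using exec.Assign[of w "\<lambda>f ss. f \<and> ss ! s = 2 \<and> ss ! x = 0" f "S (P + int m) (int c - 1 - int m)"]
    by simp
  have retreat: "exec w (Seq (Move x Right) (Move s Left)) (?f, S a b) (?f, S (a - 1) (b + 1))"
    if "0 \<le> a" "a < ?L" "-1 \<le> b" "b + 1 < ?L" for a b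
    using that by (intro exec.Seq[OF move_x[of "b + 1"] move_s]) auto
  have 4: "exec w (Seq (Move x Right) (Move s Left)) (?f, S (P + int m) (int c - 1 - int m))
      (?f, S (P + int m - 1 - int 0) (int c - int m + int 0))"
    using retreat[of "P + int m" "int c - 1 - int m"] m c L by simp
  have 5: "exec w (While (\<lambda>_ ss. ss ! s = 1) (Seq (Move x Right) (Move s Left)))
      (?f, S (P + int m - 1 - int 0) (int c - int m + int 0))
      (?f, S (P + int m - 1 - int m) (int c - int m + int m))"
  proof (rule exec_While_count)
    fix i assume i: "i < m"
    have "sym w (P + int m - 1 - int i) = 1"
      using one[of "m - 1 - i"] i m by (simp add: of_nat_diff algebra_simps)
    then show "map (sym w) (S (P + int m - 1 - int i) (int c - int m + int i)) ! s = 1 \<and>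
        exec w (Seq (Move x Right) (Move s Left)) (?f, S (P + int m - 1 - int i) (int c - int m + int i))
        (?f, S (P + int m - 1 - int (Suc i)) (int c - int m + int (Suc i)))"
      using retreat[of "P + int m - 1 - int i" "int c - int m + int i"] i m c L
      by (simp add: algebra_simps)
  next
    show "\<not> map (sym w) (S (P + int m - 1 - int m) (int c - int m + int m)) ! s = 1"
      using before by simp
  qed
  have 6: "exec w (Move s Right) (?f, S (P + int m - 1 - int m) (int c - int m + int m))
      (?f, S (P + int 0) (int c))"
    using L move_s[of "P + int 0" "P + int m - 1 - int m" Right ?f] by simp
  have 7: "exec w (While (\<lambda>_ ss. ss ! s = 1) (Move s Right)) (?f, S (P + int 0) (int c)) (?f, S (P + int v) (int c))"
  proof (rule exec_While_count)
    fix i assume i: "i < v"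
    then show "map (sym w) (S (P + int i) (int c)) ! s = 1 \<and>
        exec w (Move s Right) (?f, S (P + int i) (int c)) (?f, S (P + int (Suc i)) (int c))"
      using one[OF i] L by (auto intro!: move_s)
  qed (use two in \<open>simp\<close>)
  have 8: "exec w (Move s Right) (?f, S (P + int v) (int c)) (?f, S (P + int v + 1) (int c))"
    using L by (intro move_s) auto
  have "exec w (compare s x) (f, S P (int c)) (?f, S (P + int v + 1) (int c))"
    unfolding compare_def by (intro exec.Seq[OF 1] exec.Seq[OF 2] exec.Seq[OF 3] exec.Seq[OF 4]
      exec.Seq[OF 5] exec.Seq[OF 6] exec.Seq[OF 7] 8)
  moreover have "S P (int c) = h"
    unfolding S_def P_def by (simp flip: hs hx)
  moreover have "S (P + int v + 1) (int c) = h[s := int (length p + v + 1)]"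
    unfolding S_def list_update_swap[OF len(3)[symmetric]] by (simp add: P_def add_ac flip: hx)
  ultimately show ?thesis by simp
qed


primrec match :: "nat \<Rightarrow> nat list \<Rightarrow> prog" where
  "match s [] = Skip"
| "match s (x # xs) = Seq (compare s x) (match s xs)"

lemma encode_tuple_simps [simp]:
  "encode_tuple [] = []"
  "encode_tuple (v # t) = replicate v 1 @ 2 # encode_tuple t"
  by (simp_all add: encode_tuple_def)

lemma exec_match:
  assumes "w = p @ encode_tuple t @ q" and "q \<noteq> []" "p \<noteq> []" "last p \<noteq> 1" "0 \<notin> set w"
    and "s < length h" "h ! s = int (length p)" "length t = length xs"
    and "\<forall>x \<in> set xs. x < length h \<and> x \<noteq> s \<and> h ! x = int (g x) \<and> g x < length w"
  shows "exec w (match s xs) (f, h) (f \<and> t = map g xs, h[s := int (length (p @ encode_tuple t))])"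
  using assms
proof (induction xs arbitrary: t p f h)
  case Nil
  then have "h[s := int (length p)] = h" by (metis list_update_id)
  with Nil show ?case by (auto intro: exec.Skip)
next
  case (Cons x xs)
  then obtain v t' where t: "t = v # t'" by (cases t) auto
  let ?p = "p @ replicate v 1 @ [2]"
  let ?h = "h[s := int (length p + v + 1)]"
  have "exec w (compare s x) (f, h) (f \<and> v = g x, ?h)"
    using Cons.prems by (intro exec_compare[where q = "encode_tuple t' @ q"]) (auto simp: t)
  moreover have "exec w (match s xs) (f \<and> v = g x, ?h)
      ((f \<and> v = g x) \<and> t' = map g xs, ?h[s := int (length (?p @ encode_tuple t'))])"
    using Cons.prems by (intro Cons.IH) (auto simp: t)
  ultimately show ?case by (auto simp: t intro!: exec.Seq)
qed

text \<open>The flag doubles as the result of the search and as the reason to stop it. It is set before each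
  comparison because \<open>match\<close> only ever clears it.\<close>

definition find_tuple :: "nat \<Rightarrow> nat list \<Rightarrow> prog" where
  "find_tuple s xs = Seq (Assign (\<lambda>_ _. False))
    (While (\<lambda>f ss. \<not> f \<and> ss ! s \<noteq> 3) (Seq (Assign (\<lambda>_ _. True)) (match s xs)))"

text \<open>Tuples must not be empty: the code of an empty tuple is the empty word, whose occurrence in the list
  could not be seen.\<close>

lemma exec_find_tuple:
  assumes w: "w = p @ concat (map encode_tuple ts) @ 3 # q" and "p \<noteq> []" "last p \<noteq> 1" "0 \<notin> set w"
    and "s < length h" "h ! s = int (length p)" "\<forall>t \<in> set ts. length t = length xs" "xs \<noteq> []"
    and "\<forall>x \<in> set xs. x < length h \<and> x \<noteq> s \<and> h ! x = int (g x) \<and> g x < length w"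
  shows "\<exists>a. exec w (find_tuple s xs) (f, h) (map g xs \<in> set ts, h[s := a])"
proof -
  let ?b = "\<lambda>f ss. \<not> f \<and> ss ! s \<noteq> 3"
  let ?c = "Seq (Assign (\<lambda>_ _. True)) (match s xs)"
  have "\<exists>a. exec w (While ?b ?c) (False, h) (map g xs \<in> set ts, h[s := a])"
    using assms
  proof (induction ts arbitrary: p h)
    case Nil
    have "sym w (int (length p)) = 3" using Nil.prems(1) by (subst sym_nth) auto
    then have "exec w (While ?b ?c) (False, h) (False, h)"
      using Nil.prems by (intro exec.While_stop) auto
    then show ?case by (intro exI[of _ "h ! s"]) simp
  next
    case (Cons t ts)
    let ?p = "p @ encode_tuple t"
    let ?h = "h[s := int (length ?p)]"
    obtain v t' where t: "t = v # t'" using Cons.prems(7,8) by (cases t) auto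
    have "sym w (int (length p)) = (if v = 0 then 2 else 1)"
      using Cons.prems(1) by (subst sym_nth) (auto simp: t nth_append)
    then have b: "?b False (map (sym w) h)" using Cons.prems by auto
    have "exec w (match s xs) (True, h) (True \<and> t = map g xs, ?h)"
      using Cons.prems by (intro exec_match[where q = "concat (map encode_tuple ts) @ 3 # q"]) auto
    then have body: "exec w ?c (False, h) (t = map g xs, ?h)"
      using exec.Assign[of w "\<lambda>_ _. True" False h] by (auto intro: exec.Seq)
    have last: "?p \<noteq> []" "last ?p = 2"
    proof -
      have "last (encode_tuple t) = 2 \<and> encode_tuple t \<noteq> []" if "t \<noteq> []" for t
        using that by (induction t) (auto simp: encode_tuple_def)
      from this[of t] show "?p \<noteq> []" "last ?p = 2" using t by auto
    qed
    show ?case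
    proof (cases "t = map g xs")
      case True
      have "exec w (While ?b ?c) (True, ?h) (True, ?h)" by (intro exec.While_stop) simp
      with True b body have "exec w (While ?b ?c) (False, h) (True, ?h)"
        by (auto intro: exec.While_loop)
      with True show ?thesis by auto
    next
      case False
      have "\<exists>a. exec w (While ?b ?c) (False, ?h) (map g xs \<in> set ts, ?h[s := a])"
        using Cons.prems last by (intro Cons.IH[of ?p]) auto
      then obtain a where "exec w (While ?b ?c) (False, ?h) (map g xs \<in> set ts, h[s := a])"
        by auto
      with False b body have "exec w (While ?b ?c) (False, h) (map g xs \<in> set ts, h[s := a])"
        by (auto intro: exec.While_loop)
      with False show ?thesis by auto
    qed
  qed
  then show ?thesis
    unfolding find_tuple_def using exec.Assign[of w "\<lambda>_ _. False" f h] by (auto intro: exec.Seq)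
qed

section \<open>Deciding conditions on assignments\<close>

text \<open>The program evaluates \<open>P\<close> at the assignment that the heads in \<open>V\<close> represent, and returns these heads
  to their places. All other heads, that of the scan and those of variables bound by inner searches,
  may end anywhere. Assignments that agree on \<open>V\<close> are represented by the same
  heads, so for values below \<open>n\<close> the condition \<open>P\<close> can depend on the variables in \<open>V\<close> only.\<close>

definition decides :: "nat list \<Rightarrow> nat \<Rightarrow> nat \<Rightarrow> prog \<Rightarrow> nat set \<Rightarrow> ((nat \<Rightarrow> nat) \<Rightarrow> bool) \<Rightarrow> bool" where
  "decides w k n c V P \<longleftrightarrow>
     (\<forall>f h g. in_range w k h \<and> (\<forall>x \<in> V. g x < n \<and> h ! x = int (g x)) \<longrightarrow>
        (\<exists>h'. exec w c (f, h) (P g, h') \<and> (\<forall>x \<in> V. h' ! x = h ! x)))"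

lemma decidesE:
  assumes "decides w k n c V P" "in_range w k h" "\<forall>x \<in> V. g x < n \<and> h ! x = int (g x)"
  obtains h' where "exec w c (f, h) (P g, h')" "in_range w k h'" "\<forall>x \<in> V. h' ! x = h ! x"
  using assms exec_in_range unfolding decides_def by blast

definition atom :: "nat \<Rightarrow> nat \<Rightarrow> nat list \<Rightarrow> prog" where
  "atom s i xs = Seq (seek s (Suc i)) (find_tuple s xs)"

lemma encode_lists_segments:
  "encode_lists n tss =
    concat (map (\<lambda>u. u @ [3]) (replicate n 1 # map (\<lambda>ts. concat (map encode_tuple ts)) tss))"
  by (simp add: encode_lists_def encode_relation_def[abs_def] comp_def)

lemma set_encode_tuple: "set (encode_tuple t) \<subseteq> {1, 2}"
  by (auto simp: encode_tuple_def)

lemma set_encode_lists: "set (encode_lists n tss) \<subseteq> {1, 2, 3}"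
  by (auto simp: encode_lists_def encode_relation_def dest!: set_encode_tuple[THEN subsetD])

lemma decides_atom:
  assumes i: "i < length tss" and len: "\<forall>t \<in> set (tss ! i). length t = length xs" "xs \<noteq> []"
    and V: "set xs \<subseteq> V" "V \<subseteq> {..<s}"
  shows "decides (encode_lists n tss) (Suc s) n (atom s i xs) V (\<lambda>g. map g xs \<in> set (tss ! i))"
  unfolding decides_def
proof (intro allI impI, elim conjE)
  fix f h and g :: "nat \<Rightarrow> nat"
  let ?w = "encode_lists n tss"
  let ?us = "replicate n 1 # map (\<lambda>ts. concat (map encode_tuple ts)) tss"
  let ?seg = "\<lambda>us. concat (map (\<lambda>u. u @ [3]) us)"
  define p where "p = ?seg (take (Suc i) ?us)"
  assume h: "in_range ?w (Suc s) h" and g: "\<forall>x \<in> V. g x < n \<and> h ! x = int (g x)"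
  have w0: "0 \<notin> set ?w" using set_encode_lists by fastforce
  have no3: "\<forall>u \<in> set ?us. 3 \<notin> set u" using set_encode_tuple by fastforce
  have lenh: "length h = Suc s" using h by (simp add: in_range_def)
  have seek: "exec ?w (seek s (Suc i)) (f, h) (f, h[s := int (length p)])"
    unfolding p_def using i by (intro exec_seek[OF encode_lists_segments w0 no3 _ h]) simp_all
  have "?w = p @ ?seg (drop (Suc i) ?us)"
    unfolding encode_lists_segments p_def by (metis append_take_drop_id concat_append map_append)
  also have "drop (Suc i) ?us = ?us ! Suc i # drop (Suc (Suc i)) ?us"
    using i by (intro Cons_nth_drop_Suc[symmetric]) simp
  finally have split: "?w = p @ concat (map encode_tuple (tss ! i)) @ 3 # ?seg (drop (Suc (Suc i)) ?us)"
    using i by simp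
  have "n < length ?w" by (simp add: encode_lists_def)
  then have vars: "\<forall>x \<in> set xs. x < Suc s \<and> x \<noteq> s \<and> h ! x = int (g x) \<and> g x < length ?w"
    using g V by (fastforce dest: subsetD)
  have "take (Suc i) ?us = take i ?us @ [?us ! i]"
    using i by (intro take_Suc_conv_app_nth) simp
  then have "?seg (take (Suc i) ?us) = ?seg (take i ?us) @ ?us ! i @ [3]" by (simp only:) simp
  then obtain y where "p = y @ [3]" unfolding p_def by (metis append.assoc)
  then have p: "last p = 3" "p \<noteq> []" by simp_all
  then have "\<exists>a. exec ?w (find_tuple s xs) (f, h[s := int (length p)])
      (map g xs \<in> set (tss ! i), (h[s := int (length p)])[s := a])"
    using len lenh w0 vars p by (intro exec_find_tuple[OF split]) auto
  then obtain a where "exec ?w (atom s i xs) (f, h) (map g xs \<in> set (tss ! i), h[s := a])"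
    unfolding atom_def using seek by (auto intro: exec.Seq)
  moreover have "\<forall>x \<in> V. h[s := a] ! x = h ! x" using V by auto
  ultimately show "\<exists>h'. exec ?w (atom s i xs) (f, h) (map g xs \<in> set (tss ! i), h') \<and> (\<forall>x \<in> V. h' ! x = h ! x)"
    by blast
qed

definition search :: "nat \<Rightarrow> prog \<Rightarrow> prog" where
  "search x c = Seq (rewind x) (Seq (Assign (\<lambda>_ _. False))
    (While (\<lambda>f ss. \<not> f \<and> ss ! x = 1) (Seq c (Move x Right))))"

text \<open>Bounded existential quantification. The leading ones of the encoding serve as the range of the
  bound variable: the head runs over positions \<open>0, \<dots>, n - 1\<close> until it meets the 3 at position \<open>n\<close>.\<close>

lemma decides_search:
  assumes c: "decides w k n c (insert x V) P" and x: "x \<notin> V" "x < k"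
    and w: "w = replicate n 1 @ 3 # q" "0 \<notin> set w"
  shows "decides w k n (search x c) V (\<lambda>g. \<exists>v < n. P (g(x := v)))"
  unfolding decides_def
proof (intro allI impI, elim conjE)
  fix f h and g :: "nat \<Rightarrow> nat"
  assume h: "in_range w k h" and g: "\<forall>y \<in> V. g y < n \<and> h ! y = int (g y)"
  let ?b = "\<lambda>f ss. \<not> f \<and> ss ! x = (1 :: nat)"
  let ?c = "Seq c (Move x Right)"
  let ?P = "\<lambda>i. \<exists>v. i \<le> v \<and> v < n \<and> P (g(x := v))"
  have len: "length h = k" if "in_range w k h" for h using that by (simp add: in_range_def)
  have loop: "\<exists>h'. exec w (While ?b ?c) (False, h) (?P i, h') \<and> (\<forall>y \<in> V. h' ! y = h ! y)"
    if "i \<le> n" "in_range w k h" "\<forall>y \<in> V. h ! y = int (g y)" "h ! x = int i" for i h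
    using that
  proof (induction i arbitrary: h rule: inc_induct)
    case base
    have "sym w (int n) = 3" using sym_nth[of n w] by (simp add: w(1) nth_append)
    then have "exec w (While ?b ?c) (False, h) (False, h)"
      using base len x by (intro exec.While_stop) auto
    moreover have "?P n = False" by auto
    ultimately show ?case by (simp only:) blast
  next
    case (step i)
    have "sym w (int i) = 1" using step.hyps sym_nth[of i w] by (simp add: w(1) nth_append)
    then have b: "?b False (map (sym w) h)" using step.prems len x by auto
    have "\<forall>y \<in> insert x V. (g(x := i)) y < n \<and> h ! y = int ((g(x := i)) y)"
      using step.hyps step.prems g x by auto
    from decidesE[OF c step.prems(1) this, of False] obtain h1
      where h1: "exec w c (False, h) (P (g(x := i)), h1)" "in_range w k h1"
        "\<forall>y \<in> insert x V. h1 ! y = h ! y" by blast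
    let ?h = "h1[x := int (Suc i)]"
    have "exec w (Move x Right) (P (g(x := i)), h1) (P (g(x := i)), ?h)"
      using h1 step.hyps step.prems x len by (intro exec_Move) (auto simp: w(1))
    with h1(1) have body: "exec w ?c (False, h) (P (g(x := i)), ?h)" by (rule exec.Seq)
    have range: "in_range w k ?h" using exec_in_range[OF body step.prems(1)] .
    have keep: "\<forall>y \<in> V. ?h ! y = h ! y" using h1(3) x(1) by (metis insertCI nth_list_update_neq)
    show ?case
    proof (cases "P (g(x := i))")
      case True
      have "exec w (While ?b ?c) (True, ?h) (True, ?h)" by (intro exec.While_stop) simp
      with True b body have "exec w (While ?b ?c) (False, h) (True, ?h)"
        by (auto intro: exec.While_loop)
      moreover have "?P i = True" using True step.hyps by auto
      ultimately show ?thesis using keep by (simp only:) blast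
    next
      case False
      have "\<exists>h'. exec w (While ?b ?c) (False, ?h) (?P (Suc i), h') \<and> (\<forall>y \<in> V. h' ! y = ?h ! y)"
        using range keep step.prems x len[OF h1(2)] by (intro step.IH) auto
      then obtain h' where h': "exec w (While ?b ?c) (False, ?h) (?P (Suc i), h')"
        "\<forall>y \<in> V. h' ! y = ?h ! y" by blast
      have "?P (Suc i) = ?P i" using False by (metis Suc_le_eq le_neq_implies_less less_imp_le)
      moreover have "exec w (While ?b ?c) (False, h) (?P (Suc i), h')"
        using exec.While_loop[of ?b False w h ?c] b body h'(1) False by simp
      ultimately have "exec w (While ?b ?c) (False, h) (?P i, h')" by (simp only:)
      moreover have "\<forall>y \<in> V. h' ! y = h ! y" using h'(2) keep by simp
      ultimately show ?thesis by blast
    qed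
  qed
  have "w \<noteq> []" using w(1) by simp
  from exec_rewind[OF w(2) this h x(2)] have rew: "exec w (rewind x) (f, h) (f, h[x := 0])" .
  have keep: "\<forall>y \<in> V. h[x := 0] ! y = h ! y" using x(1) by (metis nth_list_update_neq)
  have "\<exists>h'. exec w (While ?b ?c) (False, h[x := 0]) (?P 0, h') \<and> (\<forall>y \<in> V. h' ! y = h[x := 0] ! y)"
    using exec_in_range[OF rew h] keep g x len[OF h] by (intro loop) auto
  then obtain h' where "exec w (While ?b ?c) (False, h[x := 0]) (?P 0, h')" "\<forall>y \<in> V. h' ! y = h ! y"
    using keep by auto
  moreover have "exec w (Assign (\<lambda>_ _. False)) (f, h[x := 0]) (False, h[x := 0])"
    using exec.Assign[of w "\<lambda>_ _. False"] by simp
  ultimately have "exec w (search x c) (f, h) (?P 0, h')"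
    unfolding search_def using rew by (blast intro: exec.Seq)
  with \<open>\<forall>y \<in> V. h' ! y = h ! y\<close>
  show "\<exists>h'. exec w (search x c) (f, h) (\<exists>v<n. P (g(x := v)), h') \<and> (\<forall>y \<in> V. h' ! y = h ! y)"
    by auto
qed


text \<open>The assignment \<open>g'\<close> is pinned to \<open>g\<close> outside the searched variables, so that the induction can
  peel off one quantifier at a time.\<close>

lemma decides_searches:
  assumes "decides w k n c (V \<union> set xs) P" and "distinct xs" "V \<inter> set xs = {}" "set xs \<subseteq> {..<k}"
    and "w = replicate n 1 @ 3 # q" "0 \<notin> set w"
  shows "decides w k n (foldr search xs c) V
    (\<lambda>g. \<exists>g'. (\<forall>x \<in> set xs. g' x < n) \<and> (\<forall>x. x \<notin> set xs \<longrightarrow> g' x = g x) \<and> P g')"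
  using assms(1-4)
proof (induction xs arbitrary: V)
  case Nil
  have "(\<lambda>g. \<exists>g'. (\<forall>x. g' x = g x) \<and> P g') = P" by (auto simp: fun_eq_iff[symmetric])
  with Nil show ?case by simp
next
  case (Cons x xs)
  let ?Q = "\<lambda>g. \<exists>g'. (\<forall>x \<in> set xs. g' x < n) \<and> (\<forall>x. x \<notin> set xs \<longrightarrow> g' x = g x) \<and> P g'"
  have "decides w k n (foldr search xs c) (insert x V) ?Q"
    using Cons.prems by (intro Cons.IH) auto
  then have "decides w k n (search x (foldr search xs c)) V (\<lambda>g. \<exists>v < n. ?Q (g(x := v)))"
    using Cons.prems assms(5,6) by (intro decides_search) auto
  moreover have "(\<exists>v < n. ?Q (g(x := v))) \<longleftrightarrow>
      (\<exists>g'. (\<forall>y \<in> set (x # xs). g' y < n) \<and> (\<forall>y. y \<notin> set (x # xs) \<longrightarrow> g' y = g y) \<and> P g')"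
    (is "?L \<longleftrightarrow> ?R") for g
  proof
    assume ?L
    then obtain v g' where "v < n" "\<forall>y \<in> set xs. g' y < n"
      "\<forall>y. y \<notin> set xs \<longrightarrow> g' y = (g(x := v)) y" "P g'" by blast
    moreover from this have "g' x = v" using Cons.prems(2) by simp
    ultimately show ?R by (intro exI[of _ g']) auto
  next
    assume ?R
    then obtain g' where "\<forall>y \<in> set (x # xs). g' y < n"
      "\<forall>y. y \<notin> set (x # xs) \<longrightarrow> g' y = g y" "P g'" by blast
    then show ?L by (intro exI[of _ "g' x"] conjI exI[of _ g']) auto
  qed
  ultimately show ?case by (simp only: foldr.simps comp_apply)
qed

primrec all_of :: "prog list \<Rightarrow> prog" where
  "all_of [] = Assign (\<lambda>_ _. True)"
| "all_of (c # cs) = Seq c (Cond (\<lambda>f _. f) (all_of cs) Skip)"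

primrec any_of :: "prog list \<Rightarrow> prog" where
  "any_of [] = Assign (\<lambda>_ _. False)"
| "any_of (c # cs) = Seq c (Cond (\<lambda>f _. f) Skip (any_of cs))"

lemma decides_const: "decides w k n (Assign (\<lambda>_ _. b)) V (\<lambda>_. b)"
  unfolding decides_def using exec.Assign[of w "\<lambda>_ _. b"] by auto

text \<open>\<open>Skip\<close> does not set the flag to a prescribed value, so it is not a decider by itself. It returns the
  value of the test, which is known in each branch.\<close>

lemma decides_if:
  assumes "decides w k n c V P"
    and "decides w k n d V Q \<or> d = Skip \<and> Q = (\<lambda>_. True)"
    and "decides w k n e V R \<or> e = Skip \<and> R = (\<lambda>_. False)"
  shows "decides w k n (Seq c (Cond (\<lambda>f _. f) d e)) V (\<lambda>g. if P g then Q g else R g)"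
  unfolding decides_def
proof (intro allI impI, elim conjE)
  fix f h and g :: "nat \<Rightarrow> nat"
  assume h: "in_range w k h" and g: "\<forall>x \<in> V. g x < n \<and> h ! x = int (g x)"
  from decidesE[OF assms(1) h g] obtain h1 where h1: "exec w c (f, h) (P g, h1)"
    "in_range w k h1" "\<forall>x \<in> V. h1 ! x = h ! x" by blast
  then have g1: "\<forall>x \<in> V. g x < n \<and> h1 ! x = int (g x)" using g by simp
  have "\<exists>h'. exec w (if P g then d else e) (P g, h1) (if P g then Q g else R g, h') \<and> (\<forall>x \<in> V. h' ! x = h1 ! x)"
  proof (cases "P g")
    case True
    show ?thesis using assms(2) h1(2) g1 True
      by (auto elim!: decidesE[where f = True] intro: exec.Skip)
  next
    case False
    show ?thesis using assms(3) h1(2) g1 False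
      by (auto elim!: decidesE[where f = False] intro: exec.Skip)
  qed
  then obtain h2 where h2: "exec w (if P g then d else e) (P g, h1) (if P g then Q g else R g, h2)"
    "\<forall>x \<in> V. h2 ! x = h1 ! x" by blast
  from h2(1) have "exec w (Cond (\<lambda>f _. f) d e) (P g, h1) (if P g then Q g else R g, h2)"
    by (intro exec.Cond)
  with h1(1) have "exec w (Seq c (Cond (\<lambda>f _. f) d e)) (f, h) (if P g then Q g else R g, h2)"
    by (rule exec.Seq)
  with h1(3) h2(2) show "\<exists>h'. exec w (Seq c (Cond (\<lambda>f _. f) d e)) (f, h) (if P g then Q g else R g, h') \<and>
      (\<forall>x \<in> V. h' ! x = h ! x)"
    by fastforce
qed

lemma decides_all_of:
  assumes "\<And>a. a \<in> set xs \<Longrightarrow> decides w k n (C a) V (P a)"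
  shows "decides w k n (all_of (map C xs)) V (\<lambda>g. \<forall>a \<in> set xs. P a g)"
  using assms
proof (induction xs)
  case Nil
  show ?case using decides_const[of w k n True V] by simp
next
  case (Cons a xs)
  then have "decides w k n (all_of (map C (a # xs))) V
      (\<lambda>g. if P a g then \<forall>a \<in> set xs. P a g else False)"
    unfolding list.map all_of.simps by (intro decides_if) auto
  moreover have "(\<lambda>g. if P a g then \<forall>a \<in> set xs. P a g else False) = (\<lambda>g. \<forall>a \<in> set (a # xs). P a g)"
    by auto
  ultimately show ?case by (simp only:)
qed

lemma decides_any_of:
  assumes "\<And>a. a \<in> set xs \<Longrightarrow> decides w k n (C a) V (P a)"
  shows "decides w k n (any_of (map C xs)) V (\<lambda>g. \<exists>a \<in> set xs. P a g)"
  using assms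
proof (induction xs)
  case Nil
  show ?case using decides_const[of w k n False V] by simp
next
  case (Cons a xs)
  then have "decides w k n (any_of (map C (a # xs))) V
      (\<lambda>g. if P a g then True else \<exists>a \<in> set xs. P a g)"
    unfolding list.map any_of.simps by (intro decides_if) auto
  moreover have "(\<lambda>g. if P a g then True else \<exists>a \<in> set xs. P a g) = (\<lambda>g. \<exists>a \<in> set (a # xs). P a g)"
    by auto
  ultimately show ?case by (simp only:)
qed

section \<open>Homomorphisms into an encoded structure\<close>

lemma tuple_in_structure:
  assumes "is_structure \<Delta> A" "t \<in> rel A i"
  shows "i < length \<Delta>" "length t = \<Delta> ! i" "set t \<subseteq> base A"
proof -
  show i: "i < length \<Delta>" using assms by (metis empty_iff is_structure_def not_le)
  show "length t = \<Delta> ! i" "set t \<subseteq> base A"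
    using assms i unfolding is_structure_def by blast+
qed

text \<open>The numbering \<open>vs\<close> is injective, so a homomorphism can be read off as a map into \<open>{..<length vs}\<close>, and
  tuples of \<open>G\<close> can be compared through their codes.\<close>

lemma homomorphic_iff_assignment:
  assumes F: "is_structure \<Delta> F"
    and vs: "distinct vs" "set vs = base G" "length tss = length \<Delta>"
    and tss: "\<forall>i < length \<Delta>. set (tss ! i) \<subseteq> lists {..<length vs} \<and>
      map (\<lambda>j. vs ! j) ` set (tss ! i) = rel G i"
  shows "homomorphic F G \<longleftrightarrow> (\<exists>g. (\<forall>x \<in> base F. g x < length vs) \<and>
    (\<forall>i < length \<Delta>. \<forall>t \<in> rel F i. map g t \<in> set (tss ! i)))"
proof
  assume "homomorphic F G"
  then obtain f where f: "f ` base F \<subseteq> base G" "\<And>i. map f ` rel F i \<subseteq> rel G i"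
    by (auto simp: homomorphic_def is_hom_def)
  have "\<forall>x \<in> base F. \<exists>j < length vs. vs ! j = f x"
    using f(1) vs(2) by (metis image_subset_iff in_set_conv_nth)
  then obtain g where g: "\<forall>x \<in> base F. g x < length vs \<and> vs ! g x = f x" by metis
  have "map g t \<in> set (tss ! i)" if i: "i < length \<Delta>" and t: "t \<in> rel F i" for i t
  proof -
    have tF: "set t \<subseteq> base F" using tuple_in_structure(3)[OF F t] .
    have "map f t \<in> rel G i" using f(2) t by blast
    then obtain u where u: "u \<in> set (tss ! i)" "map f t = map (\<lambda>j. vs ! j) u" using tss i by (metis imageE)
    have "map (\<lambda>j. vs ! j) u = map (\<lambda>j. vs ! j) (map g t)"
      using u(2)[symmetric] g tF by (auto simp: subset_iff)
    moreover have "inj_on (\<lambda>j. vs ! j) (set u \<union> set (map g t))"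
      using u(1) tss i g tF by (intro inj_on_nth[OF vs(1)]) auto
    ultimately have "u = map g t" using map_inj_on by blast
    with u(1) show ?thesis by simp
  qed
  with g show "\<exists>g. (\<forall>x \<in> base F. g x < length vs) \<and> (\<forall>i < length \<Delta>. \<forall>t \<in> rel F i. map g t \<in> set (tss ! i))"
    by blast
next
  assume "\<exists>g. (\<forall>x \<in> base F. g x < length vs) \<and> (\<forall>i < length \<Delta>. \<forall>t \<in> rel F i. map g t \<in> set (tss ! i))"
  then obtain g where g: "\<forall>x \<in> base F. g x < length vs"
    "\<forall>i < length \<Delta>. \<forall>t \<in> rel F i. map g t \<in> set (tss ! i)" by blast
  have "is_hom (\<lambda>x. vs ! g x) F G"
    unfolding is_hom_def
  proof (intro conjI allI subsetI)
    fix y assume "y \<in> (\<lambda>x. vs ! g x) ` base F"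
    then show "y \<in> base G" using g(1) vs(2) by auto
  next
    fix i u assume "u \<in> map (\<lambda>x. vs ! g x) ` rel F i"
    then obtain t where t: "t \<in> rel F i" "u = map (\<lambda>j. vs ! j) (map g t)" by auto
    then have i: "i < length \<Delta>" using tuple_in_structure(1)[OF F] by blast
    with g(2) t(1) have "map g t \<in> set (tss ! i)" by blast
    with t(2) tss i show "u \<in> rel G i" by blast
  qed
  then show "homomorphic F G" by (auto simp: homomorphic_def)
qed

lemma length_encode_tuple: "set t \<subseteq> {..<n} \<Longrightarrow> length (encode_tuple t) \<le> length t * n"
  by (induction t) auto

text \<open>A tuple of arity \<open>\<delta>\<close> takes at most \<open>\<delta> * N\<close> symbols in unary and a relation has at most \<open>N\<close> tuples,
  where \<open>N\<close> is the size of the structure; hence the coefficient of \<open>N^2\<close> is the sum of the arities.\<close>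

lemma length_encode_lists:
  assumes G: "is_structure \<Delta> G"
    and vs: "distinct vs" "set vs = base G" "length tss = length \<Delta>"
    and tss: "\<forall>i < length \<Delta>. distinct (tss ! i) \<and> set (tss ! i) \<subseteq> lists {..<length vs} \<and>
      map (\<lambda>j. vs ! j) ` set (tss ! i) = rel G i"
  shows "length (encode_lists (length vs) tss) \<le>
    poly [:1 + length \<Delta>, 1, sum_list \<Delta>:] (structure_size \<Delta> G)"
proof -
  let ?n = "length vs" and ?N = "structure_size \<Delta> G"
  have n: "?n \<le> ?N" using distinct_card[OF vs(1)] vs(2) by (simp add: structure_size_def)
  have rel: "length (encode_relation (tss ! i)) \<le> \<Delta> ! i * ?N * ?N + 1" if i: "i < length \<Delta>" for i
  proof -
    have inj: "inj_on (map (\<lambda>j. vs ! j)) (set (tss ! i))"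
    proof (rule inj_onI)
      fix t u assume tu: "t \<in> set (tss ! i)" "u \<in> set (tss ! i)"
        and eq: "map (\<lambda>j. vs ! j) t = map (\<lambda>j. vs ! j) u"
      have "inj_on (\<lambda>j. vs ! j) (set t \<union> set u)"
        using tu tss i by (intro inj_on_nth[OF vs(1)]) auto
      with eq show "t = u" using map_inj_on by blast
    qed
    have "length (tss ! i) = card (rel G i)"
      using tss i card_image[OF inj] distinct_card by metis
    also have "\<dots> \<le> (\<Sum>i < length \<Delta>. card (rel G i))"
      using i by (intro member_le_sum) auto
    also have "\<dots> \<le> ?N" by (simp add: structure_size_def)
    finally have len: "length (tss ! i) \<le> ?N" .
    have tup: "length (encode_tuple t) \<le> \<Delta> ! i * ?N" if t: "t \<in> set (tss ! i)" for t
    proof -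
      have "map (\<lambda>j. vs ! j) t \<in> rel G i" using t tss i by blast
      then have "length t = \<Delta> ! i" using tuple_in_structure(2)[OF G] by (metis length_map)
      moreover have "length (encode_tuple t) \<le> length t * ?n"
        using t tss i by (intro length_encode_tuple) auto
      ultimately show ?thesis using mult_le_mono2[OF n, of "\<Delta> ! i"] by (metis le_trans)
    qed
    have "length (concat (map encode_tuple (tss ! i))) = (\<Sum>t \<leftarrow> tss ! i. length (encode_tuple t))"
      by (simp add: length_concat comp_def)
    also have "\<dots> \<le> (\<Sum>t \<leftarrow> tss ! i. \<Delta> ! i * ?N)" using tup by (rule sum_list_mono)
    also have "\<dots> = length (tss ! i) * (\<Delta> ! i * ?N)" by (simp add: sum_list_triv)
    also have "\<dots> \<le> ?N * (\<Delta> ! i * ?N)" using len by (rule mult_le_mono1)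
    finally show ?thesis by (simp add: encode_relation_def mult_ac)
  qed
  have "length (concat (map encode_relation tss)) = (\<Sum>i < length \<Delta>. length (encode_relation (tss ! i)))"
    using vs(3) by (simp add: length_concat sum_list_sum_nth atLeast0LessThan)
  also have "\<dots> \<le> (\<Sum>i < length \<Delta>. \<Delta> ! i * ?N * ?N + 1)" using rel by (intro sum_mono) simp
  also have "\<dots> = sum_list \<Delta> * ?N * ?N + length \<Delta>"
    by (simp add: sum_Suc sum_list_sum_nth atLeast0LessThan sum_distrib_right)
  finally show ?thesis using n by (simp add: encode_lists_def algebra_simps)
qed

text \<open>The elements of \<open>F\<close> are natural numbers and serve directly as the tape numbers of the variables; the
  scanning head \<open>s\<close> lies beyond them.\<close>

definition hom_test :: "nat \<Rightarrow> nat \<Rightarrow> rel_structure \<Rightarrow> prog" where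
  "hom_test s m F = foldr search (sorted_list_of_set (base F))
     (all_of (map (\<lambda>(i, t). atom s i t) (SOME xs. set xs = {(i, t). i < m \<and> t \<in> rel F i})))"

lemma decides_hom_test:
  assumes "is_type \<Delta>" and F: "is_structure \<Delta> F" "base F \<subseteq> {..<s}" and G: "is_structure \<Delta> G"
    and vs: "distinct vs" "set vs = base G" "length tss = length \<Delta>"
    and tss: "\<forall>i < length \<Delta>. set (tss ! i) \<subseteq> lists {..<length vs} \<and>
      map (\<lambda>j. vs ! j) ` set (tss ! i) = rel G i"
  shows "decides (encode_lists (length vs) tss) (Suc s) (length vs) (hom_test s (length \<Delta>) F) {}
    (\<lambda>_. homomorphic F G)"
proof -
  let ?w = "encode_lists (length vs) tss" and ?n = "length vs"
  let ?A = "{(i, t). i < length \<Delta> \<and> t \<in> rel F i}"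
  let ?at = "SOME xs. set xs = ?A"
  have finF: "finite (base F)" using F(1) by (simp add: is_structure_def)
  have "finite (rel F i)" if "i < length \<Delta>" for i
    using tuple_in_structure(2,3)[OF F(1)]
    by (intro finite_subset[OF _ finite_lists_length_eq[OF finF, of "\<Delta> ! i"]]) blast
  then have "finite (SIGMA i : {..<length \<Delta>}. rel F i)" by auto
  also have "(SIGMA i : {..<length \<Delta>}. rel F i) = ?A" by auto
  finally have "\<exists>xs. set xs = ?A" by (rule finite_list)
  then have at: "set ?at = ?A" by (rule someI_ex)
  let ?P = "\<lambda>g. \<forall>a \<in> ?A. map g (snd a) \<in> set (tss ! fst a)"
  have "decides ?w (Suc s) ?n (all_of (map (\<lambda>(i, t). atom s i t) ?at)) (base F)
      (\<lambda>g. \<forall>a \<in> set ?at. map g (snd a) \<in> set (tss ! fst a))"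
  proof (intro decides_all_of)
    fix a assume "a \<in> set ?at"
    then obtain i t where a: "a = (i, t)" "i < length \<Delta>" "t \<in> rel F i"
      unfolding at by auto
    have t: "length t = \<Delta> ! i" "set t \<subseteq> base F" using tuple_in_structure[OF F(1) a(3)] by auto
    have "length u = \<Delta> ! i" if "u \<in> set (tss ! i)" for u
    proof -
      have "map (\<lambda>j. vs ! j) u \<in> rel G i" using that tss a(2) by blast
      then show ?thesis using tuple_in_structure(2)[OF G] by (metis length_map)
    qed
    moreover have "2 \<le> \<Delta> ! i" using assms(1) a(2) by (simp add: is_type_def)
    ultimately have "decides ?w (Suc s) ?n (atom s i t) (base F) (\<lambda>g. map g t \<in> set (tss ! i))"
      using a(2) t F(2) vs(3) by (intro decides_atom) auto
    then show "decides ?w (Suc s) ?n ((\<lambda>(i, t). atom s i t) a) (base F)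
        (\<lambda>g. map g (snd a) \<in> set (tss ! fst a))" by (simp add: a(1))
  qed
  then have atoms: "decides ?w (Suc s) ?n (all_of (map (\<lambda>(i, t). atom s i t) ?at))
      ({} \<union> set (sorted_list_of_set (base F))) ?P"
    unfolding at using finF by simp
  have "0 \<notin> set ?w" using set_encode_lists by fastforce
  then have "decides ?w (Suc s) ?n (hom_test s (length \<Delta>) F) {} (\<lambda>g. \<exists>g'. (\<forall>x \<in> base F. g' x < ?n) \<and>
      (\<forall>x. x \<notin> base F \<longrightarrow> g' x = g x) \<and> ?P g')"
    unfolding hom_test_def using decides_searches[OF atoms] F(2) finF
    by (force simp: encode_lists_def)
  moreover have "(\<exists>g'. (\<forall>x \<in> base F. g' x < ?n) \<and> (\<forall>x. x \<notin> base F \<longrightarrow> g' x = g x) \<and> ?P g')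
      \<longleftrightarrow> homomorphic F G" for g :: "nat \<Rightarrow> nat"
  proof -
    have P: "?P g' \<longleftrightarrow> (\<forall>i < length \<Delta>. \<forall>t \<in> rel F i. map g' t \<in> set (tss ! i))" for g' by auto
    have "\<exists>g''. (\<forall>x \<in> base F. g'' x < ?n) \<and> (\<forall>x. x \<notin> base F \<longrightarrow> g'' x = g x) \<and> ?P g''"
      if g': "\<forall>x \<in> base F. g' x < ?n" "?P g'" for g'
    proof (intro exI conjI)
      let ?g = "\<lambda>x. if x \<in> base F then g' x else g x"
      show "\<forall>x \<in> base F. ?g x < ?n" "\<forall>x. x \<notin> base F \<longrightarrow> ?g x = g x" using g'(1) by auto
      show "?P ?g"
      proof (rule ballI)
        fix a assume a: "a \<in> ?A"
        then have "snd a \<in> rel F (fst a)" by auto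
        from tuple_in_structure(3)[OF F(1) this] have "map ?g (snd a) = map g' (snd a)" by auto
        with bspec[OF g'(2) a] show "map ?g (snd a) \<in> set (tss ! fst a)" by (simp only:)
      qed
    qed
    then have "(\<exists>g'. (\<forall>x \<in> base F. g' x < ?n) \<and> (\<forall>x. x \<notin> base F \<longrightarrow> g' x = g x) \<and> ?P g') \<longleftrightarrow>
        (\<exists>g'. (\<forall>x \<in> base F. g' x < ?n) \<and> ?P g')"
      by blast
    then show ?thesis unfolding P homomorphic_iff_assignment[OF F(1) vs tss] .
  qed
  ultimately show ?thesis by simp
qed

section \<open>Dualities give polynomial-time algorithms\<close>

theorem mainTheorem6:
  fixes \<Delta> :: "nat list" and \<F> \<D> :: "rel_structure set"
  assumes "is_type \<Delta>"
    and "finite_homomorphism_duality \<Delta> \<F> \<D>"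
  shows "poly_time_decidable \<Delta> (GCSP \<D>)"
proof -
  have fin: "finite \<F>" and F: "\<And>F. F \<in> \<F> \<Longrightarrow> is_structure \<Delta> F"
    and dual: "\<And>G. is_structure \<Delta> G \<Longrightarrow> GCSP \<D> G \<longleftrightarrow> \<not> (\<exists>F \<in> \<F>. homomorphic F G)"
    using assms(2) by (auto simp: finite_homomorphism_duality_def GCSP_def)
  obtain Fs where Fs: "set Fs = \<F>" using finite_list[OF fin] by blast
  have "finite (\<Union>F \<in> \<F>. base F)" using fin F by (auto simp: is_structure_def)
  then obtain s where s: "\<And>F. F \<in> \<F> \<Longrightarrow> base F \<subseteq> {..<s}"
    by (auto simp: finite_nat_set_iff_bounded)
  \<comment> \<open>The number of tapes depends on \<open>\<F>\<close> only: one per element name below \<open>s\<close>, and one for the scan.\<close>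
  define c where "c = Seq (any_of (map (hom_test s (length \<Delta>)) Fs)) (Assign (\<lambda>f _. \<not> f))"
  define q where "q = [:1 + length \<Delta>, 1, sum_list \<Delta>:]"
  define p where "p = q + [:2:] + [:card (conts c) * 2:] * (q + [:1:]) ^ Suc s"
  have "if GCSP \<D> G then accepts_within (machine (Suc s) c) w (poly p (structure_size \<Delta> G))
      else rejects_within (machine (Suc s) c) w (poly p (structure_size \<Delta> G))"
    if G: "is_structure \<Delta> G" and enc: "encodes \<Delta> w G" for G w
  proof -
    let ?N = "structure_size \<Delta> G"
    obtain vs tss where vs: "distinct vs" "set vs = base G" "length tss = length \<Delta>"
      and tss: "\<forall>i < length \<Delta>. distinct (tss ! i) \<and> set (tss ! i) \<subseteq> lists {..<length vs} \<and>
        map (\<lambda>j. vs ! j) ` set (tss ! i) = rel G i"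
      and w: "w = encode_lists (length vs) tss"
      using enc unfolding encodes_def by blast
    have "decides w (Suc s) (length vs) (hom_test s (length \<Delta>) F) {} (\<lambda>_. homomorphic F G)"
      if "F \<in> set Fs" for F
      unfolding w using that tss s F Fs by (intro decides_hom_test[OF assms(1) _ _ G vs]) auto
    then have any: "decides w (Suc s) (length vs) (any_of (map (hom_test s (length \<Delta>)) Fs)) {}
        (\<lambda>_. \<exists>F \<in> set Fs. homomorphic F G)"
      by (rule decides_any_of)
    have ne: "w \<noteq> []" and w0: "0 \<notin> set w"
      using set_encode_lists[of "length vs" tss] by (auto simp: w encode_lists_def)
    let ?h = "replicate (Suc s) (int (length w) - 1)"
    have "in_range w (Suc s) ?h" using ne by (auto simp: in_range_def Suc_le_eq)
    from decidesE[OF any this, of _ False] obtain h where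
      "exec w (any_of (map (hom_test s (length \<Delta>)) Fs)) (False, ?h) (\<not> GCSP \<D> G, h)"
      using dual[OF G] Fs by auto
    moreover have "exec w (Assign (\<lambda>f _. \<not> f)) (\<not> GCSP \<D> G, h) (GCSP \<D> G, h)"
      using exec.Assign[of w "\<lambda>f _. \<not> f" "\<not> GCSP \<D> G" h] by simp
    ultimately have run: "exec w c (False, ?h) (GCSP \<D> G, h)"
      unfolding c_def by (rule exec.Seq)
    have len: "length w \<le> poly q ?N"
      unfolding q_def w using length_encode_lists[OF G vs tss] .
    have "length w + 2 + card (conts c) * 2 * (length w + 1) ^ Suc s \<le>
        poly q ?N + 2 + card (conts c) * 2 * (poly q ?N + 1) ^ Suc s"
      using len by (intro add_mono mult_le_mono power_mono) auto
    also have "\<dots> = poly p ?N" by (simp add: p_def)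
    finally show ?thesis
      using machine_outcome[OF run w0 ne] by (simp add: accepts_within_def rejects_within_def)
  qed
  then show ?thesis
    unfolding poly_time_decidable_def using is_tm_machine[of "Suc s" c] by fastforce
qed

end
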